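(* Let $G=(A\cup B,E)$ be a marriage instance with critical set $C\subseteq A$, and let $M$ be a popular feasible matching of $G$. Then no vertex of $G$ belongs to both a size increasing alternating path (SIAP) and a size reducing alternating path (SRAP) with respect to $M$, where levels are those assigned to $M$ by the leveling procedure described in the context.
   Context: A marriage instance is a bipartite graph $G=(A\cup B,E)$ ($A$ men, $B$ women) with strict preference lists; every vertex prefers being matched to any neighbour over being unmatched. For matchings $M,N$, $\phi(N,M)$ is the number of vertices preferring $N$ to $M$. A matching is feasible if it matches all of $C$; a popular feasible matching is a feasible $M$ with $\phi(N,M)\le\phi(M,N)$ for all feasible $N$. Edge labels: for an edge $(u,v)\notin M$, $u$ gives label $+1$ if $u$ prefers $v$ to $M(u)$ (an unmatched vertex prefers any neighbour) and $-1$ otherwise; the label is written (man's label, woman's label). An alternating path with respect to $M$ is a path whose edges alternate between $M$ and $E\setminus M$. Leveling procedure applied to $M$: initially every vertex has level $0$. Repeat the following three phases until none changes any level: Phase 1: while some edge $(m,w)$ labelled $(+1,+1)$ has level$(w)\le$ level$(m)=i$, set level$(w)$=level$(M(w))=i+1$. Phase 2: while some edge $(m,w)$ labelled $(+1,-1)$ or $(-1,+1)$ has level$(w)<$ level$(m)=i$, set level$(w)$=level$(M(w))=i$. Phase 3: while some edge $(m,w)$ labelled $(-1,-1)$ has level$(w)\le$ level$(m)-2$, level$(m)=i$, set level$(w)$=level$(M(w))=i-1$. An SRAP is an alternating path with respect to $M$ in which the number of $(+1,+1)$ edges is one more than the number of $(-1,-1)$ edges, which starts at a woman matched in $M$ at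 level $0$ and ends at a non-critical man (in $A\setminus C$) at level $1$. An SIAP is an alternating path with respect to $M$ with equally many $(+1,+1)$ and $(-1,-1)$ edges whose endpoints are a man and a woman both unmatched in $M$. *)

theory Defs
  imports Main
begin

text \<open>Edges are pairs (man, woman); a preference list is written in decreasing order of preference.\<close>

record 'v marriage_graph =
  men :: "'v set"
  women :: "'v set"
  edges :: "('v \<times> 'v) set"
  pref_list :: "'v \<Rightarrow> 'v list"

definition vertices :: "'v marriage_graph \<Rightarrow> 'v set" where
  "vertices G = men G \<union> women G"

definition adjacent :: "'v marriage_graph \<Rightarrow> 'v \<Rightarrow> 'v \<Rightarrow> bool" where
  "adjacent G u v \<longleftrightarrow> (u, v) \<in> edges G \<or> (v, u) \<in> edges G"

definition marriage_instance :: "'v marriage_graph \<Rightarrow> bool" where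
  "marriage_instance G \<longleftrightarrow>
     finite (men G) \<and> finite (women G) \<and> men G \<inter> women G = {} \<and>
     edges G \<subseteq> men G \<times> women G \<and>
     (\<forall>u\<in>vertices G. distinct (pref_list G u) \<and> set (pref_list G u) = {v. adjacent G u v})"

definition matching :: "'v marriage_graph \<Rightarrow> ('v \<times> 'v) set \<Rightarrow> bool" where
  "matching G M \<longleftrightarrow> M \<subseteq> edges G \<and>
     (\<forall>m w w'. (m, w) \<in> M \<and> (m, w') \<in> M \<longrightarrow> w = w') \<and>
     (\<forall>m m' w. (m, w) \<in> M \<and> (m', w) \<in> M \<longrightarrow> m = m')"

definition mates :: "('v \<times> 'v) set \<Rightarrow> 'v \<Rightarrow> 'v \<Rightarrow> bool" where
  "mates M u v \<longleftrightarrow> (u, v) \<in> M \<or> (v, u) \<in> M"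

definition matched :: "('v \<times> 'v) set \<Rightarrow> 'v \<Rightarrow> bool" where
  "matched M u \<longleftrightarrow> (\<exists>v. mates M u v)"

definition partner :: "('v \<times> 'v) set \<Rightarrow> 'v \<Rightarrow> 'v option" where
  "partner M u = (if matched M u then Some (THE v. mates M u v) else None)"

definition precedes :: "'a list \<Rightarrow> 'a \<Rightarrow> 'a \<Rightarrow> bool" where
  "precedes xs x y \<longleftrightarrow> (\<exists>i j. i < j \<and> j < length xs \<and> xs ! i = x \<and> xs ! j = y)"

text \<open>The value None stands for being unmatched.\<close>

fun prefers :: "'v marriage_graph \<Rightarrow> 'v \<Rightarrow> 'v option \<Rightarrow> 'v option \<Rightarrow> bool" where
  "prefers G u (Some v) (Some v') = precedes (pref_list G u) v v'"
| "prefers G u (Some v) None = True"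
| "prefers G u None x = False"

definition votes :: "'v marriage_graph \<Rightarrow> ('v \<times> 'v) set \<Rightarrow> ('v \<times> 'v) set \<Rightarrow> nat" where
  "votes G N M = card {u \<in> vertices G. prefers G u (partner N u) (partner M u)}"

definition feasible :: "'v marriage_graph \<Rightarrow> 'v set \<Rightarrow> ('v \<times> 'v) set \<Rightarrow> bool" where
  "feasible G C M \<longleftrightarrow> matching G M \<and> (\<forall>c\<in>C. matched M c)"

definition popular_feasible :: "'v marriage_graph \<Rightarrow> 'v set \<Rightarrow> ('v \<times> 'v) set \<Rightarrow> bool" where
  "popular_feasible G C M \<longleftrightarrow> feasible G C M \<and>
     (\<forall>N. feasible G C N \<longrightarrow> votes G N M \<le> votes G M N)"

text \<open>\<open>label G M u v\<close> is the label that the endpoint \<open>u\<close> gives to the edge joining \<open>u\<close> and \<open>v\<close>.\<close>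

definition label :: "'v marriage_graph \<Rightarrow> ('v \<times> 'v) set \<Rightarrow> 'v \<Rightarrow> 'v \<Rightarrow> int" where
  "label G M u v = (if prefers G u (Some v) (partner M u) then 1 else -1)"

definition labelled_edges ::
    "'v marriage_graph \<Rightarrow> ('v \<times> 'v) set \<Rightarrow> int \<times> int \<Rightarrow> ('v \<times> 'v) set" where
  "labelled_edges G M l = {(m, w) \<in> edges G - M. (label G M m w, label G M w m) = l}"

text \<open>If \<open>w\<close> is unmatched, only the level of \<open>w\<close> itself is set.\<close>

definition set_level :: "('v \<times> 'v) set \<Rightarrow> 'v \<Rightarrow> nat \<Rightarrow> ('v \<Rightarrow> nat) \<Rightarrow> 'v \<Rightarrow> nat" where
  "set_level M w i lev = (\<lambda>x. if x = w \<or> partner M w = Some x then i else lev x)"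

definition phase1_step ::
    "'v marriage_graph \<Rightarrow> ('v \<times> 'v) set \<Rightarrow> ('v \<Rightarrow> nat) \<Rightarrow> ('v \<Rightarrow> nat) \<Rightarrow> bool" where
  "phase1_step G M lev lev' \<longleftrightarrow>
     (\<exists>m w. (m, w) \<in> labelled_edges G M (1, 1) \<and> lev w \<le> lev m \<and>
        lev' = set_level M w (lev m + 1) lev)"

definition phase2_step ::
    "'v marriage_graph \<Rightarrow> ('v \<times> 'v) set \<Rightarrow> ('v \<Rightarrow> nat) \<Rightarrow> ('v \<Rightarrow> nat) \<Rightarrow> bool" where
  "phase2_step G M lev lev' \<longleftrightarrow>
     (\<exists>m w. (m, w) \<in> labelled_edges G M (1, -1) \<union> labelled_edges G M (-1, 1) \<and>
        lev w < lev m \<and> lev' = set_level M w (lev m) lev)"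

text \<open>On the naturals, \<open>lev w + 2 \<le> lev m\<close> avoids the truncated subtraction in
  \<open>lev w \<le> lev m - 2\<close> and guarantees that \<open>lev m - 1\<close> is not truncated.\<close>

definition phase3_step ::
    "'v marriage_graph \<Rightarrow> ('v \<times> 'v) set \<Rightarrow> ('v \<Rightarrow> nat) \<Rightarrow> ('v \<Rightarrow> nat) \<Rightarrow> bool" where
  "phase3_step G M lev lev' \<longleftrightarrow>
     (\<exists>m w. (m, w) \<in> labelled_edges G M (-1, -1) \<and> lev w + 2 \<le> lev m \<and>
        lev' = set_level M w (lev m - 1) lev)"

definition while_run :: "('s \<Rightarrow> 's \<Rightarrow> bool) \<Rightarrow> 's \<Rightarrow> 's \<Rightarrow> bool" where
  "while_run step s t \<longleftrightarrow> step\<^sup>*\<^sup>* s t \<and> \<not> (\<exists>t'. step t t')"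

definition leveling_round ::
    "'v marriage_graph \<Rightarrow> ('v \<times> 'v) set \<Rightarrow> ('v \<Rightarrow> nat) \<Rightarrow> ('v \<Rightarrow> nat) \<Rightarrow> bool" where
  "leveling_round G M =
     while_run (phase1_step G M) OO while_run (phase2_step G M) OO while_run (phase3_step G M)"

text \<open>The choice of edges in the three phases is not determined, so the procedure is a relation:
  \<open>leveling G M lev\<close> says that some run of it on \<open>M\<close> stops with the levels \<open>lev\<close>.\<close>

definition leveling :: "'v marriage_graph \<Rightarrow> ('v \<times> 'v) set \<Rightarrow> ('v \<Rightarrow> nat) \<Rightarrow> bool" where
  "leveling G M lev \<longleftrightarrow>
     (leveling_round G M)\<^sup>*\<^sup>* (\<lambda>_. 0) lev \<and> leveling_round G M lev lev"

definition alternating_path :: "'v marriage_graph \<Rightarrow> ('v \<times> 'v) set \<Rightarrow> 'v list \<Rightarrow> bool" where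
  "alternating_path G M p \<longleftrightarrow>
     p \<noteq> [] \<and> set p \<subseteq> vertices G \<and> distinct p \<and> successively (adjacent G) p \<and>
     (\<forall>i. i + 2 < length p \<longrightarrow>
        (mates M (p ! i) (p ! (i + 1)) \<longleftrightarrow> \<not> mates M (p ! (i + 1)) (p ! (i + 2))))"

text \<open>Both orientations of every edge of the path are included, whatever the direction of travel.\<close>

definition path_edges :: "'v list \<Rightarrow> ('v \<times> 'v) set" where
  "path_edges p = {(p ! i, p ! (i + 1)) | i. i + 1 < length p} \<union>
                  {(p ! (i + 1), p ! i) | i. i + 1 < length p}"

definition num_labelled ::
    "'v marriage_graph \<Rightarrow> ('v \<times> 'v) set \<Rightarrow> int \<times> int \<Rightarrow> 'v list \<Rightarrow> nat" where
  "num_labelled G M l p = card (labelled_edges G M l \<inter> path_edges p)"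

definition SRAP ::
    "'v marriage_graph \<Rightarrow> 'v set \<Rightarrow> ('v \<times> 'v) set \<Rightarrow> ('v \<Rightarrow> nat) \<Rightarrow> 'v list \<Rightarrow> bool" where
  "SRAP G C M lev p \<longleftrightarrow> alternating_path G M p \<and>
     num_labelled G M (1, 1) p = num_labelled G M (-1, -1) p + 1 \<and>
     hd p \<in> women G \<and> matched M (hd p) \<and> lev (hd p) = 0 \<and>
     last p \<in> men G - C \<and> lev (last p) = 1"

text \<open>The path is undirected; the list traverses it from its man endpoint to its woman endpoint.\<close>

definition SIAP :: "'v marriage_graph \<Rightarrow> ('v \<times> 'v) set \<Rightarrow> 'v list \<Rightarrow> bool" where
  "SIAP G M p \<longleftrightarrow> alternating_path G M p \<and>
     num_labelled G M (1, 1) p = num_labelled G M (-1, -1) p \<and>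
     hd p \<in> men G \<and> \<not> matched M (hd p) \<and>
     last p \<in> women G \<and> \<not> matched M (last p)"

end

theory Submission
  imports Defs
begin

text \<open>
  Give an edge outside \<open>M\<close> weight \<open>1\<close>, \<open>0\<close> or \<open>-1\<close>, half the sum of its labels. Switching
  \<open>M\<close> to new edges of total weight \<open>x\<close> that leaves one vertex unmatched gains at least \<open>2 x - 1\<close> votes,
  so popularity gives \<open>x \<le> 0\<close> unless that vertex is critical. When the procedure stops, the
  levels are a potential: constant on \<open>M\<close>, and rising by at least the weight from man to woman
  on every other edge. An SRAP rises from level \<open>0\<close> to level \<open>1\<close> with weight \<open>1\<close>, so all of its
  edges are tight.

  If an SIAP \<open>p\<close> and an SRAP \<open>q\<close> meet, they share matching edges, traversed in the same direction.
  Following \<open>p\<close> up to the first common woman \<open>w\<^sub>1\<close> and then \<open>q\<close> gives a simple alternating path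
  that loses only the non-critical end of \<open>q\<close>; following \<open>q\<close> up to the last common woman \<open>w\<^sub>2\<close>
  on \<open>p\<close> and then \<open>p\<close> gives one that loses only the woman at the start of \<open>q\<close>. By popularity the
  part of \<open>p\<close> before \<open>w\<^sub>1\<close> has weight at most \<open>lev w\<^sub>1 - 1\<close> and the part after \<open>w\<^sub>2\<close> at most
  \<open>- lev w\<^sub>2\<close>, and by the potential the part in between has weight at most \<open>lev w\<^sub>2 - lev w\<^sub>1\<close>.
  Hence \<open>p\<close> has negative weight, a contradiction.
\<close>

section \<open>Partners and preferences in a bipartite graph\<close>

locale marriage_matching =
  fixes G :: "'v marriage_graph" and M :: "('v \<times> 'v) set"
  assumes inst: "marriage_instance G" and M: "matching G M"
begin

lemma edges_sub: "edges G \<subseteq> men G \<times> women G"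
  and men_women_disjoint: "men G \<inter> women G = {}"
  and finite_vertices: "finite (vertices G)"
  using inst by (auto simp: marriage_instance_def vertices_def)

lemma edgeD: "(m, w) \<in> edges G \<Longrightarrow> m \<in> men G \<and> w \<in> women G"
  using edges_sub by blast

lemma finite_edges: "finite (edges G)"
  using inst finite_subset[OF edges_sub] by (auto simp: marriage_instance_def)

text \<open>Because \<open>mates\<close> is symmetric, a vertex could a priori be the man of one
  edge and the woman of another; disjointness of the two sides excludes this. The matching is
  arbitrary because the result is also needed for the switched matching.\<close>

lemma mates_unique:
  assumes "matching G N" "mates N u v" "mates N u v'"
  shows "v = v'"
proof -
  have N: "N \<subseteq> edges G" "\<And>m w w'. (m, w) \<in> N \<Longrightarrow> (m, w') \<in> N \<Longrightarrow> w = w'"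
    "\<And>m m' w. (m, w) \<in> N \<Longrightarrow> (m', w) \<in> N \<Longrightarrow> m = m'"
    using assms(1) unfolding matching_def by blast+
  have "\<not> ((u, x) \<in> N \<and> (y, u) \<in> N)" for x y
    using N(1) edgeD men_women_disjoint by blast
  with assms(2,3) N(2,3) show ?thesis
    unfolding mates_def by blast
qed

lemma partner_eq_Some_iff:
  assumes "matching G N"
  shows "partner N u = Some v \<longleftrightarrow> mates N u v"
proof
  assume *: "mates N u v"
  then have "(THE v. mates N u v) = v"
    using mates_unique[OF assms] by (intro the_equality) auto
  with * show "partner N u = Some v"
    by (auto simp: partner_def matched_def)
next
  assume "partner N u = Some v"
  then have "matched N u" "v = (THE v. mates N u v)"
    by (auto simp: partner_def split: if_splits)
  moreover from this obtain v' where v': "mates N u v'"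
    by (auto simp: matched_def)
  moreover have "(THE v. mates N u v) = v'"
    using v' mates_unique[OF assms] by (intro the_equality) auto
  ultimately show "mates N u v" by simp
qed

lemma M_unique:
  "(m, w) \<in> M \<Longrightarrow> (m, w') \<in> M \<Longrightarrow> w = w'"
  "(m, w) \<in> M \<Longrightarrow> (m', w) \<in> M \<Longrightarrow> m = m'"
  using M unfolding matching_def by blast+

lemma M_edges: "M \<subseteq> edges G"
  using M by (simp add: matching_def)

lemma mates_man: "u \<in> men G \<Longrightarrow> mates M u v \<longleftrightarrow> (u, v) \<in> M"
  and mates_woman: "u \<in> women G \<Longrightarrow> mates M u v \<longleftrightarrow> (v, u) \<in> M"
  and adjacent_man: "u \<in> men G \<Longrightarrow> adjacent G u v \<longleftrightarrow> (u, v) \<in> edges G"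
  and adjacent_woman: "u \<in> women G \<Longrightarrow> adjacent G u v \<longleftrightarrow> (v, u) \<in> edges G"
  using M_edges edgeD men_women_disjoint unfolding mates_def adjacent_def by blast+

text \<open>In a distinct list every entry has one position, so opposite preferences would order the
  same two positions both ways.\<close>

lemma prefers_asym:
  assumes "u \<in> vertices G" "prefers G u x y"
  shows "\<not> prefers G u y x"
proof -
  have d: "distinct (pref_list G u)"
    using assms(1) inst by (auto simp: marriage_instance_def)
  have "\<not> (precedes (pref_list G u) v v' \<and> precedes (pref_list G u) v' v)" for v v'
  proof (rule notI, unfold precedes_def, elim conjE exE)
    fix i j i' j'
    assume "i < j" "j < length (pref_list G u)" "pref_list G u ! i = v" "pref_list G u ! j = v'"
      "i' < j'" "j' < length (pref_list G u)" "pref_list G u ! i' = v'" "pref_list G u ! j' = v"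
    moreover from this have "i = j'" "j = i'"
      using nth_eq_iff_index_eq[OF d] by (metis less_trans)+
    ultimately show False by simp
  qed
  with assms(2) show ?thesis
    by (cases x; cases y) auto
qed

section \<open>Edge weights and the votes gained by a switch\<close>

definition edge_weight :: "'v \<times> 'v \<Rightarrow> int" where
  "edge_weight e = (label G M (fst e) (snd e) + label G M (snd e) (fst e)) div 2"

text \<open>Both labels are 1 or -1, so their sum is even and \<open>div\<close> loses
  nothing.\<close>

lemma two_edge_weight:
  "2 * edge_weight e = label G M (fst e) (snd e) + label G M (snd e) (fst e)"
  by (auto simp: edge_weight_def label_def)

text \<open>Edges with mixed labels have weight 0, so only the two counted kinds contribute. The
  counting conditions on an SIAP and an SRAP thus become total weights 0 and 1.\<close>

lemma num_labelled_diff: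
  "int (num_labelled G M (1, 1) p) - int (num_labelled G M (-1, -1) p) =
   (\<Sum>e\<in>path_edges p \<inter> (edges G - M). edge_weight e)"
proof -
  let ?S = "path_edges p \<inter> (edges G - M)"
  have fin: "finite ?S" using finite_edges by auto
  have w: "edge_weight e = of_bool (e \<in> labelled_edges G M (1, 1))
      - of_bool (e \<in> labelled_edges G M (-1, -1))" if "e \<in> ?S" for e
    using that by (auto simp: edge_weight_def labelled_edges_def label_def split: prod.splits)
  have s: "labelled_edges G M l \<inter> path_edges p = ?S \<inter> {e. e \<in> labelled_edges G M l}" for l
    by (auto simp: labelled_edges_def)
  have "(\<Sum>e\<in>?S. edge_weight e) = (\<Sum>e\<in>?S. of_bool (e \<in> labelled_edges G M (1, 1))
      - of_bool (e \<in> labelled_edges G M (-1, -1)))"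
    using w by (rule sum.cong[OF refl])
  then show ?thesis
    unfolding num_labelled_def s using fin by (simp add: sum_subtractf sum_of_bool_eq)
qed

text \<open>\<open>D\<close> is switched into \<open>M\<close>, and \<open>z\<close> is the only vertex that may lose its partner.\<close>

lemma switch_weight_nonpos:
  assumes pop: "popular_feasible G C M" and C: "C \<subseteq> men G"
    and D: "matching G D" "D \<inter> M = {}" and z: "z \<notin> C"
    and lost_w: "\<And>m w. (m, w) \<in> M \<Longrightarrow> m \<in> fst ` D \<Longrightarrow> w \<notin> snd ` D \<Longrightarrow> w = z"
    and lost_m: "\<And>m w. (m, w) \<in> M \<Longrightarrow> w \<in> snd ` D \<Longrightarrow> m \<notin> fst ` D \<Longrightarrow> m = z"
  shows "(\<Sum>e\<in>D. edge_weight e) \<le> 0"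
proof -
  \<comment> \<open>Every edge of \<open>M\<close> sharing an endpoint with \<open>D\<close> is
    dropped, which keeps \<open>N\<close> a matching.\<close>
  define N where "N = D \<union> {e \<in> M. fst e \<notin> fst ` D \<and> snd e \<notin> snd ` D}"
  have Dsub: "D \<subseteq> edges G" using D by (simp add: matching_def)
  have finD: "finite D" using Dsub finite_edges finite_subset by blast
  have D_unique: "(m, w) \<in> D \<Longrightarrow> (m, w') \<in> D \<Longrightarrow> w = w'"
    "(m, w) \<in> D \<Longrightarrow> (m', w) \<in> D \<Longrightarrow> m = m'" for m m' w w'
    using D unfolding matching_def by blast+
  have N: "matching G N"
    unfolding matching_def
  proof (intro conjI allI impI)
    show "N \<subseteq> edges G" using Dsub M_edges by (auto simp: N_def)
    show "w = w'" if "(m, w) \<in> N \<and> (m, w') \<in> N" for m w w'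
      using that D_unique M_unique unfolding N_def by (force simp: image_iff)
    show "m = m'" if "(m, w) \<in> N \<and> (m', w) \<in> N" for m m' w
      using that D_unique M_unique unfolding N_def by (force simp: image_iff)
  qed
  \<comment> \<open>A critical man not covered by \<open>D\<close> keeps his edge of
    \<open>M\<close>: otherwise \<open>lost_m\<close> would identify him with \<open>z\<close>,
    which is not critical.\<close>
  have "matched N c" if c: "c \<in> C" for c
  proof -
    have "matched M c" using pop c by (simp add: popular_feasible_def feasible_def)
    then obtain v where v: "(c, v) \<in> M"
      using mates_man C c unfolding matched_def by blast
    show ?thesis
    proof (cases "c \<in> fst ` D")
      case True
      then show ?thesis by (force simp: matched_def mates_def N_def)
    next
      case False
      then have "(c, v) \<in> N" using v lost_m z c by (auto simp: N_def)
      then show ?thesis by (auto simp: matched_def mates_def)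
    qed
  qed
  with N have "feasible G C N" by (simp add: feasible_def)
  with pop have votes_le: "votes G N M \<le> votes G M N"
    by (simp add: popular_feasible_def)
  define vote :: "'v \<Rightarrow> int" where
    "vote u = of_bool (prefers G u (partner N u) (partner M u))
      - of_bool (prefers G u (partner M u) (partner N u))" for u
  have votes: "int (votes G N M) - int (votes G M N) = (\<Sum>u\<in>vertices G. vote u)"
    using finite_vertices
    by (simp add: votes_def vote_def sum_subtractf sum_of_bool_eq Int_def conj_commute)
  \<comment> \<open>The use of \<open>the\<close> is safe: \<open>L\<close> is only evaluated at
    endpoints of \<open>D\<close>, which \<open>N\<close> matches along \<open>D\<close>.\<close>
  define L where "L u = label G M u (the (partner N u))" for u
  let ?X = "fst ` D" and ?Y = "snd ` D"
  have XY: "?X \<subseteq> men G" "?Y \<subseteq> women G" using Dsub edgeD by auto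
  have disj: "?X \<inter> ?Y = {}" using XY men_women_disjoint by auto
  have sub: "?X \<union> ?Y \<subseteq> vertices G" using XY by (auto simp: vertices_def)
  have partner_D: "partner N m = Some w" "partner N w = Some m" if "(m, w) \<in> D" for m w
    using that unfolding partner_eq_Some_iff[OF N] by (auto simp: mates_def N_def)
  \<comment> \<open>Label 1 is a vote for \<open>N\<close>, and asymmetry rules out an opposing one;
    for label -1 the bound is trivial, since no vote is below -1.\<close>
  have in_D: "vote u \<ge> L u" if u: "u \<in> ?X \<union> ?Y" for u
  proof -
    obtain v where v: "partner N u = Some v" using u partner_D by force
    have "u \<in> vertices G" using u sub by auto
    then show ?thesis
      using prefers_asym[of u "Some v" "partner M u"] v
      by (auto simp: vote_def L_def label_def)
  qed
  have off_D: "vote u \<ge> - of_bool (u = z)" if "u \<notin> ?X \<union> ?Y" for u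
  proof (cases "u = z")
    case False
    have "mates N u v \<longleftrightarrow> mates M u v" for v
    proof
      assume "mates N u v"
      then show "mates M u v" using that by (force simp: mates_def N_def)
    next
      assume "mates M u v"
      then show "mates N u v"
        using that lost_m[of u v] lost_w[of v u] False by (auto simp: mates_def N_def)
    qed
    then have "mates N u = mates M u" by (intro ext)
    then have "partner N u = partner M u" by (simp add: partner_def matched_def)
    then show ?thesis by (simp add: vote_def)
  qed (auto simp: vote_def)
  have L_sum: "(\<Sum>u\<in>?X \<union> ?Y. L u) = 2 * (\<Sum>e\<in>D. edge_weight e)"
  proof -
    have inj: "inj_on fst D" "inj_on snd D"
      using D_unique by (auto simp: inj_on_def)
    have "(\<Sum>u\<in>?X. L u) = (\<Sum>e\<in>D. label G M (fst e) (snd e))"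
      using partner_D by (auto simp: sum.reindex[OF inj(1)] L_def intro!: sum.cong)
    moreover have "(\<Sum>u\<in>?Y. L u) = (\<Sum>e\<in>D. label G M (snd e) (fst e))"
      using partner_D by (auto simp: sum.reindex[OF inj(2)] L_def intro!: sum.cong)
    ultimately show ?thesis
      using finD disj
      by (simp add: sum.union_disjoint sum_distrib_left two_edge_weight sum.distrib)
  qed
  have "(\<Sum>u\<in>vertices G. vote u) = (\<Sum>u\<in>?X \<union> ?Y. vote u) + (\<Sum>u\<in>vertices G - (?X \<union> ?Y). vote u)"
    using sum.subset_diff[OF sub finite_vertices, of vote] by simp
  moreover have "(\<Sum>u\<in>?X \<union> ?Y. vote u) \<ge> 2 * (\<Sum>e\<in>D. edge_weight e)"
    unfolding L_sum[symmetric] using in_D by (intro sum_mono) auto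
  moreover have "(\<Sum>u\<in>vertices G - (?X \<union> ?Y). vote u)
      \<ge> (\<Sum>u\<in>vertices G - (?X \<union> ?Y). - of_bool (u = z))"
    using off_D by (intro sum_mono) auto
  moreover have "(\<Sum>u\<in>vertices G - (?X \<union> ?Y). of_bool (u = z) :: int) \<le> 1"
    using finite_vertices by (auto simp: of_bool_def)
  \<comment> \<open>With \<open>x\<close> the weight of \<open>D\<close>, the estimates give
    \<open>2 * x - 1 \<le> 0\<close>; as \<open>x\<close> is an integer,
    \<open>x \<le> 0\<close>.\<close>
  ultimately show ?thesis using votes votes_le by (simp add: sum_negf)
qed

section \<open>The final levels as a potential\<close>

lemma step_increases:
  assumes M_eq: "\<forall>(m, w)\<in>M. lev m = lev w"
    and step: "phase1_step G M lev lev' \<or> phase2_step G M lev lev' \<or> phase3_step G M lev lev'"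
  shows "(\<forall>(m, w)\<in>M. lev' m = lev' w) \<and> lev < lev'"
proof -
  \<comment> \<open>All three phases have one shape: a woman \<open>w\<close>, with her partner if
    she has one, is raised to a common level \<open>i\<close> above her old one.\<close>
  obtain w i where w: "w \<in> women G" "lev w < i" and lev': "lev' = set_level M w i lev"
    using step
  proof (elim disjE)
    assume "phase1_step G M lev lev'"
    then obtain m w where "(m, w) \<in> labelled_edges G M (1, 1)" "lev w \<le> lev m"
      "lev' = set_level M w (lev m + 1) lev" by (auto simp: phase1_step_def)
    with that[of w "lev m + 1"] edgeD show ?thesis by (force simp: labelled_edges_def)
  next
    assume "phase2_step G M lev lev'"
    then obtain m w where "(m, w) \<in> labelled_edges G M (1, -1) \<union> labelled_edges G M (-1, 1)"
      "lev w < lev m" "lev' = set_level M w (lev m) lev" by (auto simp: phase2_step_def)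
    with that[of w "lev m"] edgeD show ?thesis by (force simp: labelled_edges_def)
  next
    assume "phase3_step G M lev lev'"
    then obtain m w where "(m, w) \<in> labelled_edges G M (-1, -1)" "lev w + 2 \<le> lev m"
      "lev' = set_level M w (lev m - 1) lev" by (auto simp: phase3_step_def)
    with that[of w "lev m - 1"] edgeD show ?thesis by (force simp: labelled_edges_def)
  qed
  have p: "partner M w = Some x \<longleftrightarrow> (x, w) \<in> M" for x
    using partner_eq_Some_iff[OF M] mates_woman w by simp
  have lev'_eq: "lev' x = (if x = w \<or> (x, w) \<in> M then i else lev x)" for x
    by (simp add: lev' set_level_def p)
  \<comment> \<open>The partner of \<open>w\<close> had her old level by \<open>M_eq\<close>, so he
    rises as well.\<close>
  have "lev x \<le> lev' x" for x
    using w M_eq by (auto simp: lev'_eq)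
  moreover have "lev w < lev' w" using w by (simp add: lev'_eq)
  ultimately have "lev < lev'"
    unfolding less_fun_def le_fun_def by (meson not_le)
  moreover have "lev' m = lev' w'" if "(m, w') \<in> M" for m w'
  proof -
    have "m \<noteq> w" using that w M_edges edgeD men_women_disjoint by blast
    moreover have "(w', w) \<notin> M" using that M_edges edgeD men_women_disjoint by blast
    moreover have "lev m = lev w'" using M_eq that by blast
    moreover have "(m, w) \<in> M \<longleftrightarrow> w' = w" using that M_unique by blast
    ultimately show ?thesis by (simp add: lev'_eq)
  qed
  ultimately show ?thesis by blast
qed

lemma steps_increase:
  assumes "step\<^sup>*\<^sup>* lev lev'" "\<forall>(m, w)\<in>M. lev m = lev w"
    and "step \<in> {phase1_step G M, phase2_step G M, phase3_step G M}"
  shows "(\<forall>(m, w)\<in>M. lev' m = lev' w) \<and> lev \<le> lev'"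
  using assms(1,2)
proof (induction rule: rtranclp_induct)
  case (step y z)
  then have "(\<forall>(m, w)\<in>M. z m = z w) \<and> y < z"
    using assms(3) by (intro step_increases) auto
  with step show ?case by (meson less_imp_le order_trans)
qed auto

text \<open>Steps preserve equal levels along \<open>M\<close> and only raise levels. A round that
  returns to its starting levels therefore takes no step, and the failed guards of phases 1, 2 and 3
  give the inequality for weights 1, 0 and -1 respectively.\<close>

lemma leveling_stable:
  assumes "leveling G M lev"
  shows "(m, w) \<in> M \<Longrightarrow> lev m = lev w"
    and "(m, w) \<in> edges G - M \<Longrightarrow> edge_weight (m, w) \<le> int (lev w) - int (lev m)"
proof -
  have round: "\<exists>s t. (phase1_step G M)\<^sup>*\<^sup>* l s \<and> (phase2_step G M)\<^sup>*\<^sup>* s t \<and> (phase3_step G M)\<^sup>*\<^sup>* t l'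
      \<and> \<not> Ex (phase1_step G M s) \<and> \<not> Ex (phase2_step G M t) \<and> \<not> Ex (phase3_step G M l')"
    if "leveling_round G M l l'" for l l'
    using that unfolding leveling_round_def while_run_def OO_def by blast
  have "(leveling_round G M)\<^sup>*\<^sup>* (\<lambda>_. 0) lev" and idle: "leveling_round G M lev lev"
    using assms by (auto simp: leveling_def)
  from this(1) have eq: "\<forall>(m, w)\<in>M. lev m = lev w"
  proof (induction rule: rtranclp_induct)
    case (step y z)
    from round[OF step(2)] obtain s t where *: "(phase1_step G M)\<^sup>*\<^sup>* y s"
      "(phase2_step G M)\<^sup>*\<^sup>* s t" "(phase3_step G M)\<^sup>*\<^sup>* t z" by blast
    have "\<forall>(m, w)\<in>M. s m = s w" using steps_increase[OF *(1) step(3)] by simp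
    from steps_increase[OF *(2) this] have "\<forall>(m, w)\<in>M. t m = t w" by simp
    from steps_increase[OF *(3) this] show ?case by simp
  qed simp
  then show "(m, w) \<in> M \<Longrightarrow> lev m = lev w" by blast
  obtain s t where *: "(phase1_step G M)\<^sup>*\<^sup>* lev s" "(phase2_step G M)\<^sup>*\<^sup>* s t"
    "(phase3_step G M)\<^sup>*\<^sup>* t lev" and
    stop: "\<not> Ex (phase1_step G M s)" "\<not> Ex (phase2_step G M t)" "\<not> Ex (phase3_step G M lev)"
    using round[OF idle] by blast
  have s: "\<forall>(m, w)\<in>M. s m = s w" "lev \<le> s"
    using steps_increase[OF *(1) eq] by simp_all
  have t: "\<forall>(m, w)\<in>M. t m = t w" "s \<le> t"
    using steps_increase[OF *(2) s(1)] by simp_all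
  \<comment> \<open>The last round goes from \<open>lev\<close> through \<open>s\<close> and
    \<open>t\<close> back to \<open>lev\<close>, so monotonicity makes all of them equal and the
    three stopping conditions hold at \<open>lev\<close> itself.\<close>
  have "t \<le> lev" using steps_increase[OF *(3) t(1)] by simp
  with s(2) t(2) have "s = lev" "t = lev" by (meson order_antisym order_trans)+
  note stop = stop[unfolded this]
  assume "(m, w) \<in> edges G - M"
  then have e: "(m, w) \<in> labelled_edges G M (label G M m w, label G M w m)"
    by (simp add: labelled_edges_def)
  have "\<not> lev w \<le> lev m" if "label G M m w = 1" "label G M w m = 1"
    using stop(1) e that unfolding phase1_step_def by auto
  moreover have "\<not> lev w < lev m" if "label G M m w = - label G M w m"
  proof -
    have "(m, w) \<in> labelled_edges G M (1, -1) \<union> labelled_edges G M (-1, 1)"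
      using e that by (auto simp: label_def split: if_splits)
    with stop(2) show ?thesis unfolding phase2_step_def by blast
  qed
  moreover have "\<not> lev w + 2 \<le> lev m" if "label G M m w = -1" "label G M w m = -1"
    using stop(3) e that unfolding phase3_step_def by auto
  ultimately show "edge_weight (m, w) \<le> int (lev w) - int (lev m)"
    by (auto simp: edge_weight_def label_def split: if_splits)
qed

section \<open>Alternating paths as indexed sequences of men and women\<close>

lemma alternating_path_mates:
  assumes "alternating_path G M p" "Suc i < length p"
  shows "mates M (p ! i) (p ! Suc i) \<longleftrightarrow> (even i \<longleftrightarrow> mates M (p ! 0) (p ! 1))"
  using assms(2)
proof (induction i)
  case (Suc i)
  then have "mates M (p ! i) (p ! (i + 1)) \<longleftrightarrow> \<not> mates M (p ! (i + 1)) (p ! (i + 2))"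
    using assms(1) unfolding alternating_path_def by auto
  with Suc show ?case by auto
qed simp

lemma alternating_path_adjacent:
  assumes "alternating_path G M p" "Suc i < length p"
  shows "adjacent G (p ! i) (p ! Suc i)"
  using assms by (simp add: alternating_path_def successively_conv_nth)

lemma alternating_path_sex:
  assumes "alternating_path G M p" "i < length p"
  shows "p ! i \<in> (if even i \<longleftrightarrow> p ! 0 \<in> men G then men G else women G)"
  using assms(2)
proof (induction i)
  case 0
  have "p ! 0 \<in> vertices G" using assms(1) 0 by (auto simp: alternating_path_def)
  then show ?case by (auto simp: vertices_def)
next
  case (Suc i)
  then have "adjacent G (p ! i) (p ! Suc i)"
    using alternating_path_adjacent[OF assms(1)] by simp
  with Suc adjacent_man[of "p ! i" "p ! Suc i"] adjacent_woman[of "p ! i" "p ! Suc i"]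
    edgeD men_women_disjoint show ?case by (auto split: if_splits)
qed

text \<open>Of the two orientations in \<open>path_edges\<close>, only the one with the man first
  can lie in \<open>edges G\<close>; \<open>f\<close> and \<open>g\<close> pick out its man and its
  woman, and \<open>I\<close> the steps outside \<open>M\<close>. This turns weights of paths into
  sums over positions.\<close>

lemma path_edges_non_matching:
  assumes "\<And>i. Suc i < length p \<Longrightarrow> i \<in> I
      \<Longrightarrow> (f i, g i) \<in> edges G - M \<and> {f i, g i} = {p ! i, p ! Suc i}"
    and "\<And>i. Suc i < length p \<Longrightarrow> i \<notin> I \<Longrightarrow> mates M (p ! i) (p ! Suc i)"
  shows "path_edges p \<inter> (edges G - M) = (\<lambda>i. (f i, g i)) ` {i \<in> I. Suc i < length p}"
proof -
  have anti: "(w, m) \<notin> edges G" if "(m, w) \<in> edges G" for m w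
    using that edgeD men_women_disjoint by blast
  have "\<not> (u, v) \<in> edges G - M" if "mates M u v" for u v
    using that anti M_edges by (auto simp: mates_def)
  moreover have "mates M u v \<longleftrightarrow> mates M v u" for u v
    by (auto simp: mates_def)
  ultimately have off: "i \<in> I" if "Suc i < length p"
    "(p ! i, p ! Suc i) \<in> edges G - M \<or> (p ! Suc i, p ! i) \<in> edges G - M" for i
    using that assms(2) by blast
  show ?thesis
  proof (intro equalityI subsetI)
    fix e assume "e \<in> path_edges p \<inter> (edges G - M)"
    then obtain i where i: "Suc i < length p" "e = (p ! i, p ! Suc i) \<or> e = (p ! Suc i, p ! i)"
      and e: "e \<in> edges G - M" by (auto simp: path_edges_def)
    then have "i \<in> I" using off by auto
    with assms(1)[OF i(1)] i e anti have "e = (f i, g i)"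
      by (auto simp: doubleton_eq_iff)
    with i \<open>i \<in> I\<close> show "e \<in> (\<lambda>i. (f i, g i)) ` {i \<in> I. Suc i < length p}" by blast
  next
    fix e assume "e \<in> (\<lambda>i. (f i, g i)) ` {i \<in> I. Suc i < length p}"
    then obtain i where i: "i \<in> I" "Suc i < length p" "e = (f i, g i)" by blast
    with assms(1)[of i] show "e \<in> path_edges p \<inter> (edges G - M)"
      by (auto simp: path_edges_def doubleton_eq_iff)
  qed
qed

text \<open>The path reads \<open>a 0, b 0, a 1, b 1, ..., a n, b n\<close>. Its first man is
  unmatched, so the first edge is outside \<open>M\<close>, and parity of the position decides the
  type of every later edge.\<close>

lemma SIAP_obtains:
  assumes "SIAP G M p"
  obtains a n b where "inj_on a {..n}" "inj_on b {..n}" "set p = a ` {..n} \<union> b ` {..n}"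
    "\<forall>i\<le>n. (a i, b i) \<in> edges G - M" "\<forall>i<n. (a (Suc i), b i) \<in> M"
    "\<not> matched M (a 0)" "\<not> matched M (b n)" "(\<Sum>i\<le>n. edge_weight (a i, b i)) = 0"
proof -
  have p: "alternating_path G M p" "p \<noteq> []" "distinct p"
    and num: "num_labelled G M (1, 1) p = num_labelled G M (-1, -1) p"
    and hd: "p ! 0 \<in> men G" "\<not> matched M (p ! 0)"
    and last: "p ! (length p - 1) \<in> women G" "\<not> matched M (p ! (length p - 1))"
    using assms by (auto simp: SIAP_def alternating_path_def hd_conv_nth last_conv_nth)
  have sex: "p ! i \<in> (if even i then men G else women G)" if "i < length p" for i
    using alternating_path_sex[OF p(1) that] hd by simp
  have "odd (length p - 1)"
    using sex[of "length p - 1"] last p(2) men_women_disjoint by (auto split: if_splits)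
  then obtain n where "length p - 1 = 2 * n + 1" by (elim oddE)
  then have len: "length p = 2 * n + 2" by simp
  define a b where "a i = p ! (2 * i)" and "b i = p ! (2 * i + 1)" for i
  have "\<not> mates M (p ! 0) (p ! 1)" using hd by (auto simp: matched_def)
  then have mates: "mates M (p ! i) (p ! Suc i) \<longleftrightarrow> odd i" if "Suc i < length p" for i
    using alternating_path_mates[OF p(1) that] by auto
  have ab: "(a i, b i) \<in> edges G - M" if "i \<le> n" for i
    using mates[of "2 * i"] sex[of "2 * i"] alternating_path_adjacent[OF p(1), of "2 * i"] that
    by (auto simp: a_def b_def len mates_man adjacent_man)
  have ba: "(a (Suc i), b i) \<in> M" if "i < n" for i
    using mates[of "2 * i + 1"] sex[of "2 * i + 1"] that
    by (auto simp: a_def b_def len mates_woman)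
  have inj: "inj_on a {..n}" "inj_on b {..n}"
    using p(3) by (auto simp: inj_on_def a_def b_def nth_eq_iff_index_eq len)
  have set: "set p = a ` {..n} \<union> b ` {..n}"
  proof -
    have "i \<in> (\<lambda>i. 2 * i) ` {..n} \<union> (\<lambda>i. 2 * i + 1) ` {..n}" if "i < 2 * n + 2" for i
      using that by (cases "even i") (auto elim!: evenE oddE)
    then have "{..<2 * n + 2} = (\<lambda>i. 2 * i) ` {..n} \<union> (\<lambda>i. 2 * i + 1) ` {..n}" by auto
    moreover have "set p = (!) p ` {..<2 * n + 2}" by (auto simp: set_conv_nth len)
    ultimately show ?thesis by (simp add: image_Un image_image a_def[abs_def] b_def[abs_def])
  qed
  have "path_edges p \<inter> (edges G - M)
    = (\<lambda>i. (p ! i, p ! Suc i)) ` {i \<in> {i. even i}. Suc i < length p}"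
  proof (rule path_edges_non_matching[where f = "\<lambda>i. p ! i"
      and g = "\<lambda>i. p ! Suc i" and I = "{i. even i}"])
    fix i assume "Suc i < length p" "i \<in> {i. even i}"
    then obtain k where "i = 2 * k" "k \<le> n"
      using len by (auto elim!: evenE)
    with ab[of k] show "(p ! i, p ! Suc i) \<in> edges G - M \<and> {p ! i, p ! Suc i} = {p ! i, p ! Suc i}"
      by (auto simp: a_def b_def)
  qed (use mates in auto)
  also have "{i \<in> {i. even i}. Suc i < length p} = (\<lambda>i. 2 * i) ` {..n}"
    by (auto simp: len elim!: evenE)
  finally have edges: "path_edges p \<inter> (edges G - M) = (\<lambda>i. (a i, b i)) ` {..n}"
    by (simp add: image_image a_def b_def)
  have "(\<Sum>i\<le>n. edge_weight (a i, b i)) = (\<Sum>e\<in>path_edges p \<inter> (edges G - M). edge_weight e)"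
    unfolding edges using inj by (subst sum.reindex) (auto simp: inj_on_def)
  also have "\<dots> = 0" using num num_labelled_diff[of p] by simp
  finally show ?thesis
    using that inj set ab ba hd last by (simp add: a_def b_def len)
qed

text \<open>The path reads \<open>c 0, d 0, c 1, d 1, ..., c l, d l\<close>, beginning with an edge
  of \<open>M\<close>. The definition of an SRAP leaves the type of the first edge open; the levels
  exclude the other type.\<close>

lemma SRAP_obtains:
  assumes "SRAP G C M lev q" and lev: "leveling G M lev"
  obtains c l d where "inj_on c {..l}" "inj_on d {..l}" "set q = c ` {..l} \<union> d ` {..l}"
    "\<forall>i\<le>l. (d i, c i) \<in> M" "\<forall>i<l. (d i, c (Suc i)) \<in> edges G - M"
    "c 0 \<in> women G" "d l \<notin> C" "lev (c 0) = 0" "lev (d l) = 1"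
    "(\<Sum>i<l. edge_weight (d i, c (Suc i))) = 1"
proof -
  have q: "alternating_path G M q" "q \<noteq> []" "distinct q"
    and num: "num_labelled G M (1, 1) q = num_labelled G M (-1, -1) q + 1"
    and hd: "q ! 0 \<in> women G" "lev (q ! 0) = 0"
    and last: "q ! (length q - 1) \<in> men G" "q ! (length q - 1) \<notin> C" "lev (q ! (length q - 1)) = 1"
    using assms by (auto simp: SRAP_def alternating_path_def hd_conv_nth last_conv_nth)
  have sex: "q ! i \<in> (if even i then women G else men G)" if "i < length q" for i
    using alternating_path_sex[OF q(1) that] hd men_women_disjoint by (auto split: if_splits)
  have "odd (length q - 1)"
    using sex[of "length q - 1"] last q(2) men_women_disjoint by (auto split: if_splits)
  then obtain l where "length q - 1 = 2 * l + 1" by (elim oddE)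
  then have len: "length q = 2 * l + 2" by simp
  define c d where "c i = q ! (2 * i)" and "d i = q ! (2 * i + 1)" for i
  have inj: "inj_on c {..l}" "inj_on d {..l}"
    using q(3) by (auto simp: inj_on_def c_def d_def nth_eq_iff_index_eq len)
  have set: "set q = c ` {..l} \<union> d ` {..l}"
  proof -
    have "i \<in> (\<lambda>i. 2 * i) ` {..l} \<union> (\<lambda>i. 2 * i + 1) ` {..l}" if "i < 2 * l + 2" for i
      using that by (cases "even i") (auto elim!: evenE oddE)
    then have "{..<2 * l + 2} = (\<lambda>i. 2 * i) ` {..l} \<union> (\<lambda>i. 2 * i + 1) ` {..l}" by auto
    moreover have "set q = (!) q ` {..<2 * l + 2}" by (auto simp: set_conv_nth len)
    ultimately show ?thesis by (simp add: image_Un image_image c_def[abs_def] d_def[abs_def])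
  qed
  have weight: "(\<Sum>e\<in>path_edges q \<inter> (edges G - M). edge_weight e) = 1"
    using num num_labelled_diff[of q] by simp
  show ?thesis
  proof (cases "mates M (q ! 0) (q ! 1)")
    case True
    then have mates: "mates M (q ! i) (q ! Suc i) \<longleftrightarrow> even i" if "Suc i < length q" for i
      using alternating_path_mates[OF q(1) that] by auto
    have dc: "(d i, c i) \<in> M" if "i \<le> l" for i
      using mates[of "2 * i"] sex[of "2 * i"] that
      by (auto simp: c_def d_def len mates_woman)
    have cd: "(d i, c (Suc i)) \<in> edges G - M" if "i < l" for i
      using mates[of "2 * i + 1"] sex[of "2 * i + 1"]
        alternating_path_adjacent[OF q(1), of "2 * i + 1"] that
      by (auto simp: c_def d_def len mates_man adjacent_man)
    have "path_edges q \<inter> (edges G - M)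
      = (\<lambda>i. (q ! i, q ! Suc i)) ` {i \<in> {i. odd i}. Suc i < length q}"
    proof (rule path_edges_non_matching[where f = "\<lambda>i. q ! i"
        and g = "\<lambda>i. q ! Suc i" and I = "{i. odd i}"])
      fix i assume "Suc i < length q" "i \<in> {i. odd i}"
      then obtain k where "i = 2 * k + 1" "k < l"
        using len by (auto elim!: oddE)
      with cd[of k] show "(q ! i, q ! Suc i) \<in> edges G - M \<and> {q ! i, q ! Suc i} = {q ! i, q ! Suc i}"
        by (auto simp: c_def d_def)
    qed (use mates in auto)
    also have "{i \<in> {i. odd i}. Suc i < length q} = (\<lambda>i. 2 * i + 1) ` {..<l}"
      by (auto simp: len elim!: oddE)
    finally have edges: "path_edges q \<inter> (edges G - M) = (\<lambda>i. (d i, c (Suc i))) ` {..<l}"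
      by (simp add: image_image c_def d_def)
    have "(\<Sum>i<l. edge_weight (d i, c (Suc i))) = 1"
      unfolding weight[symmetric] edges using inj by (subst sum.reindex) (auto simp: inj_on_def)
    then show ?thesis
      using that inj set dc cd hd last by (simp add: c_def d_def len)
  next
    case False
    \<comment> \<open>The path then runs against the direction in which the levels rise, and the last man
      would have level at most \<open>-1\<close>.\<close>
    then have mates: "mates M (q ! i) (q ! Suc i) \<longleftrightarrow> odd i" if "Suc i < length q" for i
      using alternating_path_mates[OF q(1) that] by auto
    have dc: "(d i, c i) \<in> edges G - M" if "i \<le> l" for i
      using mates[of "2 * i"] sex[of "2 * i"] alternating_path_adjacent[OF q(1), of "2 * i"] that
      by (auto simp: c_def d_def len mates_woman adjacent_woman)
    have cd: "(d i, c (Suc i)) \<in> M" if "i < l" for i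
      using mates[of "2 * i + 1"] sex[of "2 * i + 1"] that
      by (auto simp: c_def d_def len mates_man)
    have "path_edges q \<inter> (edges G - M)
      = (\<lambda>i. (q ! Suc i, q ! i)) ` {i \<in> {i. even i}. Suc i < length q}"
    proof (rule path_edges_non_matching[where f = "\<lambda>i. q ! Suc i"
        and g = "\<lambda>i. q ! i" and I = "{i. even i}"])
      fix i assume "Suc i < length q" "i \<in> {i. even i}"
      then obtain k where "i = 2 * k" "k \<le> l"
        using len by (auto elim!: evenE)
      with dc[of k] show "(q ! Suc i, q ! i) \<in> edges G - M \<and> {q ! Suc i, q ! i} = {q ! i, q ! Suc i}"
        by (auto simp: c_def d_def)
    qed (use mates in auto)
    also have "{i \<in> {i. even i}. Suc i < length q} = (\<lambda>i. 2 * i) ` {..l}"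
      by (auto simp: len elim!: evenE)
    finally have edges: "path_edges q \<inter> (edges G - M) = (\<lambda>i. (d i, c i)) ` {..l}"
      by (simp add: image_image c_def d_def)
    have "1 = (\<Sum>i\<le>l. edge_weight (d i, c i))"
      unfolding weight[symmetric] edges using inj by (subst sum.reindex) (auto simp: inj_on_def)
    moreover have "(\<Sum>i\<le>k. edge_weight (d i, c i)) \<le> int (lev (c 0)) - int (lev (d k))" if "k \<le> l" for k
      using that
    proof (induction k)
      case 0
      then show ?case using leveling_stable(2)[OF lev dc[of 0]] by simp
    next
      case (Suc k)
      then show ?case
        using leveling_stable(2)[OF lev dc[of "Suc k"]] leveling_stable(1)[OF lev cd[of k]] by simp
    qed
    ultimately have False using hd last by (fastforce simp: c_def d_def len)
    then show ?thesis ..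
  qed
qed

section \<open>Splicing an SIAP and an SRAP that meet\<close>

theorem SIAP_SRAP_disjoint:
  assumes pop: "popular_feasible G C M" and C: "C \<subseteq> men G" and lev: "leveling G M lev"
    and p: "SIAP G M p" and q: "SRAP G C M lev q"
  shows "set p \<inter> set q = {}"
proof (rule ccontr)
  assume meet: "set p \<inter> set q \<noteq> {}"
  obtain a n b where inj_a: "inj_on a {..n}" and inj_b: "inj_on b {..n}"
    and set_p: "set p = a ` {..n} \<union> b ` {..n}"
    and ab: "\<forall>i\<le>n. (a i, b i) \<in> edges G - M"
    and ba: "\<forall>i<n. (a (Suc i), b i) \<in> M"
    and a0: "\<not> matched M (a 0)" and bn: "\<not> matched M (b n)"
    and wp: "(\<Sum>i\<le>n. edge_weight (a i, b i)) = 0"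
    by (rule SIAP_obtains[OF p])
  obtain c l d where inj_c: "inj_on c {..l}" and inj_d: "inj_on d {..l}"
    and set_q: "set q = c ` {..l} \<union> d ` {..l}"
    and dc: "\<forall>i\<le>l. (d i, c i) \<in> M"
    and cd: "\<forall>i<l. (d i, c (Suc i)) \<in> edges G - M"
    and c0: "c 0 \<in> women G" "lev (c 0) = 0" and dl: "d l \<notin> C" "lev (d l) = 1"
    and wq: "(\<Sum>i<l. edge_weight (d i, c (Suc i))) = 1"
    by (rule SRAP_obtains[OF q lev])
  note ab = ab[rule_format] and ba = ba[rule_format]
    and dc = dc[rule_format] and cd = cd[rule_format]
  have a0: "(a 0, w) \<notin> M" and bn: "(m, b n) \<notin> M" for m w
    using a0 bn by (auto simp: matched_def mates_def)
  \<comment> \<open>Along \<open>p\<close>, the edge of \<open>M\<close> at a man leads back to the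
    preceding woman, and at a woman on to the next man; the two ends have none.\<close>
  have a_in_M: "\<exists>j. i = Suc j \<and> w = b j" if "(a i, w) \<in> M" "i \<le> n" for i w
    using that a0 ba[of "i - 1"] M_unique by (cases i) fastforce+
  have b_in_M: "i < n \<and> m = a (Suc i)" if "(m, b i) \<in> M" "i \<le> n" for i m
    using that bn ba[of i] M_unique by (cases "i = n") fastforce+
  have d_in_M: "w = c i" if "(d i, w) \<in> M" "i \<le> l" for i w
    using that dc M_unique by blast
  have c_in_M: "m = d i" if "(m, c i) \<in> M" "i \<le> l" for i m
    using that dc M_unique by blast
  \<comment> \<open>A common vertex brings its partner along, so the paths share whole edges of
    \<open>M\<close>, and both traverse them from woman to man.\<close>
  have a_d: "\<exists>i'. i = Suc i' \<and> b i' = c j" if "a i = d j" "i \<le> n" "j \<le> l" for i j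
    using a_in_M[of i "c j"] dc[of j] that by auto
  have b_c: "i < n \<and> a (Suc i) = d j" if "b i = c j" "i \<le> n" "j \<le> l" for i j
    using b_in_M[of "d j" i] dc[of j] that by auto
  define S where "S = {s. s \<le> n \<and> (\<exists>t\<le>l. b s = c t)}"
  have finS: "finite S" by (simp add: S_def)
  \<comment> \<open>A common man yields the common woman just before him; a man of one path cannot
    be a woman of the other.\<close>
  have "S \<noteq> {}"
  proof -
    obtain v where "v \<in> set p" "v \<in> set q" using meet by blast
    then have v: "v \<in> a ` {..n} \<union> b ` {..n}" "v \<in> c ` {..l} \<union> d ` {..l}"
      by (simp_all only: set_p set_q)
    have men: "a i \<in> men G" "b i \<in> women G" if "i \<le> n" for i
      using ab[OF that] edgeD[of "a i" "b i"] by auto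
    have women: "d i \<in> men G" "c i \<in> women G" if "i \<le> l" for i
      using dc[OF that] M_edges edgeD[of "d i" "c i"] by auto
    from v show ?thesis
    proof (elim UnE imageE)
      fix i j assume "v = a i" "i \<in> {..n}" "v = d j" "j \<in> {..l}"
      with a_d[of i j] show ?thesis by (fastforce simp: S_def)
    next
      fix i j assume "v = b i" "i \<in> {..n}" "v = c j" "j \<in> {..l}"
      then show ?thesis by (fastforce simp: S_def)
    qed (use men women men_women_disjoint in \<open>fastforce+\<close>)
  qed
  \<comment> \<open>First and last common woman in the order of \<open>p\<close>. Nothing is claimed
    about the order of their positions \<open>t1\<close> and \<open>t2\<close> on
    \<open>q\<close>.\<close>
  define s1 s2 where "s1 = Min S" and "s2 = Max S"
  have "s1 \<in> S" "s2 \<in> S" using finS \<open>S \<noteq> {}\<close> by (auto simp: s1_def s2_def)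
  then obtain t1 t2 where t1: "t1 \<le> l" "b s1 = c t1" and t2: "t2 \<le> l" "b s2 = c t2"
    and s_le: "s1 \<le> n" "s2 \<le> n"
    by (auto simp: S_def)
  have "s1 \<le> s2" using finS \<open>s1 \<in> S\<close> by (simp add: s2_def)
  have first: "s1 \<le> i" if "b i = c j" "i \<le> n" "j \<le> l" for i j
    using that finS by (auto simp: s1_def S_def intro!: Min_le)
  have last: "i \<le> s2" if "b i = c j" "i \<le> n" "j \<le> l" for i j
    using that finS by (auto simp: s2_def S_def intro!: Max_ge)

  let ?P = "\<lambda>i. (a i, b i)" and ?Q = "\<lambda>i. (d i, c (Suc i))"
  have injP: "inj_on ?P I" if "I \<subseteq> {..n}" for I
    using inj_on_subset[OF inj_a that] by (auto simp: inj_on_def)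
  have injQ: "inj_on ?Q I" if "I \<subseteq> {..<l}" for I
  proof -
    have "I \<subseteq> {..l}" using that by auto
    from inj_on_subset[OF inj_d this] show ?thesis by (auto simp: inj_on_def)
  qed
  \<comment> \<open>Common form of both switches: non-matching edges of \<open>p\<close> and
    \<open>q\<close> can be combined as soon as no edge taken from \<open>p\<close> meets one taken
    from \<open>q\<close>.\<close>
  have spliced: "(\<Sum>e\<in>?P ` I \<union> ?Q ` J. edge_weight e)
      = (\<Sum>i\<in>I. edge_weight (a i, b i)) + (\<Sum>j\<in>J. edge_weight (d j, c (Suc j)))"
    and spliced_matching: "matching G (?P ` I \<union> ?Q ` J)" "(?P ` I \<union> ?Q ` J) \<inter> M = {}"
    if I: "I \<subseteq> {..n}" and J: "J \<subseteq> {..<l}"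
      and disj: "\<And>i j. i \<in> I \<Longrightarrow> j \<in> J \<Longrightarrow> a i \<noteq> d j \<and> b i \<noteq> c (Suc j)" for I J
  proof -
    have "finite I" "finite J" using I J finite_subset by blast+
    moreover have "?P ` I \<inter> ?Q ` J = {}" using disj by auto
    ultimately show "(\<Sum>e\<in>?P ` I \<union> ?Q ` J. edge_weight e)
      = (\<Sum>i\<in>I. edge_weight (a i, b i)) + (\<Sum>j\<in>J. edge_weight (d j, c (Suc j)))"
      using injP[OF I] injQ[OF J] by (simp add: sum.union_disjoint sum.reindex)
    have eq: "a i = a i' \<longleftrightarrow> i = i'" "b i = b i' \<longleftrightarrow> i = i'" if "i \<in> I" "i' \<in> I" for i i'
    proof -
      have "i \<le> n" "i' \<le> n" using that I by auto
      then show "a i = a i' \<longleftrightarrow> i = i'" "b i = b i' \<longleftrightarrow> i = i'"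
        using inj_on_eq_iff[OF inj_a] inj_on_eq_iff[OF inj_b] by auto
    qed
    have eq': "d i = d i' \<longleftrightarrow> i = i'" "c (Suc i) = c (Suc i') \<longleftrightarrow> i = i'"
      if "i \<in> J" "i' \<in> J" for i i'
    proof -
      have "i < l" "i' < l" using that J by auto
      then show "d i = d i' \<longleftrightarrow> i = i'" "c (Suc i) = c (Suc i') \<longleftrightarrow> i = i'"
        using inj_on_eq_iff[OF inj_d] inj_on_eq_iff[OF inj_c] by auto
    qed
    have "?P i \<in> edges G - M" if "i \<in> I" for i using that I ab by blast
    moreover have "?Q j \<in> edges G - M" if "j \<in> J" for j using that J cd by blast
    ultimately have sub: "?P ` I \<union> ?Q ` J \<subseteq> edges G - M" by blast
    then show "(?P ` I \<union> ?Q ` J) \<inter> M = {}" by blast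
    show "matching G (?P ` I \<union> ?Q ` J)"
      unfolding matching_def
    proof (intro conjI allI impI)
      show "?P ` I \<union> ?Q ` J \<subseteq> edges G" using sub by blast
    next
      fix m w w' assume "(m, w) \<in> ?P ` I \<union> ?Q ` J \<and> (m, w') \<in> ?P ` I \<union> ?Q ` J"
      then show "w = w'"
        by (elim conjE UnE imageE) (simp_all, metis eq(1), metis disj, metis disj, metis eq'(1))
    next
      fix m m' w assume "(m, w) \<in> ?P ` I \<union> ?Q ` J \<and> (m', w) \<in> ?P ` I \<union> ?Q ` J"
      then show "m = m'"
        by (elim conjE UnE imageE) (simp_all, metis eq(2), metis disj, metis disj, metis eq'(2))
    qed
  qed

  \<comment> \<open>First switch: \<open>a 0\<close> gains a partner, the path changes from
    \<open>p\<close> to \<open>q\<close> at the woman \<open>b s1 = c t1\<close>, and the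
    non-critical man \<open>d l\<close> is left out.\<close>
  have "(\<Sum>i\<in>{..s1}. edge_weight (a i, b i)) + (\<Sum>j\<in>{t1..<l}. edge_weight (d j, c (Suc j))) \<le> 0"
  proof -
    let ?D = "?P ` {..s1} \<union> ?Q ` {t1..<l}"
    have disj: "a i \<noteq> d j \<and> b i \<noteq> c (Suc j)" if ij: "i \<in> {..s1}" "j \<in> {t1..<l}" for i j
    proof (intro conjI notI)
      assume "a i = d j"
      then obtain i' where "i = Suc i'" "b i' = c j" using a_d[of i j] ij s_le by auto
      with first[of i' j] that s_le show False by auto
    next
      assume *: "b i = c (Suc j)"
      then have "i = s1" using first[of i "Suc j"] that s_le by auto
      then have "c t1 = c (Suc j)" using * t1 by simp
      then show False using inj_onD[OF inj_c] that t1 by fastforce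
    qed
    note I = spliced[OF _ _ disj] spliced_matching[OF _ _ disj]
    have sub: "{..s1} \<subseteq> {..n}" "{t1..<l} \<subseteq> {..<l}" using s_le by auto
    have D_fst: "a i \<in> fst ` ?D" if "i \<le> s1" for i using that by force
    have D_fst': "d j \<in> fst ` ?D" if "t1 \<le> j" "j < l" for j using that by force
    have D_snd: "b i \<in> snd ` ?D" if "i \<le> s1" for i using that by force
    \<comment> \<open>The junction woman \<open>c t1\<close> is covered by the last edge taken from
      \<open>p\<close>, the later ones by edges of \<open>q\<close>.\<close>
    have D_snd': "c j \<in> snd ` ?D" if j: "t1 \<le> j" "j \<le> l" for j
    proof (cases "j = t1")
      case True
      then show ?thesis using D_snd[of s1] t1 by simp
    next
      case False
      then obtain k where "j = Suc k" "t1 \<le> k" "k < l" using j by (cases j) auto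
      then show ?thesis by force
    qed
    have "(\<Sum>e\<in>?D. edge_weight e) \<le> 0"
    proof (rule switch_weight_nonpos[OF pop C I(2,3)[OF sub] dl(1)])
      fix m w assume mw: "(m, w) \<in> M" and "m \<in> fst ` ?D" "w \<notin> snd ` ?D"
      then consider i where "i \<le> s1" "m = a i" | j where "t1 \<le> j" "j < l" "m = d j" by force
      then have "w \<in> snd ` ?D"
      proof cases
        case 1
        then obtain k where "i = Suc k" "w = b k" using a_in_M[of i w] mw s_le by auto
        with 1 D_snd[of k] show ?thesis by auto
      next
        case 2
        then have "w = c j" using d_in_M mw by auto
        with 2 D_snd' show ?thesis by auto
      qed
      with \<open>w \<notin> snd ` ?D\<close> show "w = d l" ..
    next
      fix m w assume mw: "(m, w) \<in> M" and w: "w \<in> snd ` ?D" and m: "m \<notin> fst ` ?D"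
      have m_d: "m = d l" if "w = c j" "t1 \<le> j" "j \<le> l" for j
      proof -
        have "m = d j" using c_in_M[of m j] mw that by auto
        with D_fst'[of j] m that show ?thesis by (cases "j = l") auto
      qed
      from w consider i where "i \<le> s1" "w = b i" | j where "t1 \<le> j" "j < l" "w = c (Suc j)"
        by force
      then show "m = d l"
      proof cases
        case 1
        show ?thesis
        proof (cases "i = s1")
          case True
          with 1 m_d[of t1] t1 show ?thesis by simp
        next
          case False
          have "m = a (Suc i)" using b_in_M[of m i] mw 1 s_le by auto
          with 1 False D_fst[of "Suc i"] m show ?thesis by auto
        qed
      next
        case 2
        with m_d[of "Suc j"] show ?thesis by simp
      qed
    qed
    then show ?thesis using I(1)[OF sub] by simp
  qed
  moreover
  \<comment> \<open>Second switch: the woman \<open>c 0\<close> is left out, the path changes from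
    \<open>q\<close> to \<open>p\<close> after \<open>c t2 = b s2\<close>, and \<open>b n\<close>
    gains a partner.\<close>
  have "(\<Sum>i\<in>{s2<..n}. edge_weight (a i, b i)) + (\<Sum>j\<in>{..<t2}. edge_weight (d j, c (Suc j))) \<le> 0"
  proof -
    let ?D = "?P ` {s2<..n} \<union> ?Q ` {..<t2}"
    have disj: "a i \<noteq> d j \<and> b i \<noteq> c (Suc j)" if ij: "i \<in> {s2<..n}" "j \<in> {..<t2}" for i j
    proof (intro conjI notI)
      assume "a i = d j"
      then obtain i' where i': "i = Suc i'" "b i' = c j" using a_d[of i j] ij t2 by auto
      then have "i' = s2" using last[of i' j] ij t2 by auto
      then have "c t2 = c j" using i' t2 by simp
      then show False using inj_onD[OF inj_c] that t2 by fastforce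
    next
      assume "b i = c (Suc j)"
      with last[of i "Suc j"] that t2 show False by auto
    qed
    note I = spliced[OF _ _ disj] spliced_matching[OF _ _ disj]
    have sub: "{s2<..n} \<subseteq> {..n}" "{..<t2} \<subseteq> {..<l}" using t2 by auto
    \<comment> \<open>The last common woman is matched, hence not the end of \<open>p\<close>. Her
      partner is the junction man, covered by the first edge taken from \<open>p\<close>.\<close>
    have s2: "s2 < n" "a (Suc s2) = d t2" using b_c[of s2 t2] t2 s_le by auto
    have D_fst: "a i \<in> fst ` ?D" if "s2 < i" "i \<le> n" for i using that by force
    have D_fst': "d j \<in> fst ` ?D" if "j \<le> t2" for j
    proof (cases "j = t2")
      case True
      then show ?thesis using D_fst[of "Suc s2"] s2 by simp
    next
      case False
      then show ?thesis using that by force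
    qed
    have D_snd: "b i \<in> snd ` ?D" if "s2 < i" "i \<le> n" for i using that by force
    have D_snd': "c (Suc j) \<in> snd ` ?D" if "j < t2" for j using that by force
    have z: "c 0 \<notin> C" using c0 C men_women_disjoint by auto
    have "(\<Sum>e\<in>?D. edge_weight e) \<le> 0"
    proof (rule switch_weight_nonpos[OF pop C I(2,3)[OF sub] z])
      fix m w assume mw: "(m, w) \<in> M" and m: "m \<in> fst ` ?D" and w: "w \<notin> snd ` ?D"
      have w_c: "w = c 0" if "m = d j" "j \<le> t2" for j
      proof -
        have "w = c j" using d_in_M[of j w] mw that t2 by auto
        with D_snd'[of "j - 1"] w that show ?thesis by (cases j) auto
      qed
      from m consider i where "s2 < i" "i \<le> n" "m = a i" | j where "j < t2" "m = d j"
        by force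
      then show "w = c 0"
      proof cases
        case 1
        then obtain k where k: "i = Suc k" "w = b k" using a_in_M[of i w] mw by auto
        show ?thesis
        proof (cases "k = s2")
          case True
          with 1 k s2 w_c[of t2] show ?thesis by simp
        next
          case False
          with 1 k D_snd[of k] w show ?thesis by auto
        qed
      next
        case 2
        with w_c[of j] show ?thesis by simp
      qed
    next
      fix m w assume mw: "(m, w) \<in> M" and "w \<in> snd ` ?D" and m: "m \<notin> fst ` ?D"
      then consider i where "s2 < i" "i \<le> n" "w = b i" | j where "j < t2" "w = c (Suc j)"
        by force
      then have "m \<in> fst ` ?D"
      proof cases
        case 1
        then have "i < n" "m = a (Suc i)" using b_in_M mw by auto
        with 1 D_fst[of "Suc i"] show ?thesis by auto
      next
        case 2
        then have "m = d (Suc j)" using c_in_M mw t2 by auto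
        with 2 D_fst' show ?thesis by auto
      qed
      with m show "m = c 0" ..
    qed
    then show ?thesis using I(1)[OF sub] by simp
  qed
  moreover
  define g where "g t = int (lev (c t))" for t
  have lev_d: "int (lev (d t)) = g t" if "t \<le> l" for t
    using leveling_stable(1)[OF lev dc[OF that]] by (simp add: g_def)
  have q_le: "(\<Sum>j\<in>{t..<t'}. edge_weight (d j, c (Suc j))) \<le> g t' - g t" if "t \<le> t'" "t' \<le> l" for t t'
  proof -
    have "(\<Sum>j\<in>{t..<t'}. edge_weight (d j, c (Suc j))) \<le> (\<Sum>j\<in>{t..<t'}. g (Suc j) - g j)"
    proof (rule sum_mono)
      fix j assume "j \<in> {t..<t'}"
      then show "edge_weight (d j, c (Suc j)) \<le> g (Suc j) - g j"
        using leveling_stable(2)[OF lev cd[of j]] lev_d[of j] that by (simp add: g_def)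
    qed
    then show ?thesis using that by (simp add: sum_Suc_diff')
  qed
  have q_split: "(\<Sum>j\<in>{..<t}. edge_weight (d j, c (Suc j)))
      + (\<Sum>j\<in>{t..<l}. edge_weight (d j, c (Suc j))) = 1" if "t \<le> l" for t
    using wq sum.atLeastLessThan_concat[of 0 t l "\<lambda>j. edge_weight (d j, c (Suc j))"] that
    by (simp add: atLeast0LessThan)
  have g: "g 0 = 0" "g l = 1" using c0 dl lev_d[of l] by (auto simp: g_def)
  \<comment> \<open>The total weight of \<open>q\<close> equals its total rise 1, so the upper bound
    on one part of \<open>q\<close> becomes a lower bound on the other.\<close>
  have "(\<Sum>j\<in>{t1..<l}. edge_weight (d j, c (Suc j))) \<ge> 1 - g t1"
    using q_le[of 0 t1] q_split[of t1] t1 g by (simp add: atLeast0LessThan)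
  moreover have "(\<Sum>j\<in>{..<t2}. edge_weight (d j, c (Suc j))) \<ge> g t2"
    using q_le[of t2 l] q_split[of t2] t2 g by simp
  moreover have "(\<Sum>i\<in>{s1<..s2}. edge_weight (a i, b i)) \<le> g t2 - g t1"
  proof -
    define h where "h i = int (lev (b i))" for i
    \<comment> \<open>The man \<open>a (Suc i)\<close> has the level of \<open>b i\<close>, so after
      the index shift the bounds telescope along the women.\<close>
    have "{s1<..s2} = {Suc s1..<Suc s2}" by auto
    then have "(\<Sum>i\<in>{s1<..s2}. edge_weight (a i, b i))
        = (\<Sum>i\<in>{s1..<s2}. edge_weight (a (Suc i), b (Suc i)))"
      by (simp only: sum.shift_bounds_Suc_ivl)
    also have "\<dots> \<le> (\<Sum>i\<in>{s1..<s2}. h (Suc i) - h i)"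
    proof (rule sum_mono)
      fix i assume "i \<in> {s1..<s2}"
      then have "i < n" using s_le by auto
      then show "edge_weight (a (Suc i), b (Suc i)) \<le> h (Suc i) - h i"
        using leveling_stable(2)[OF lev ab[of "Suc i"]] leveling_stable(1)[OF lev ba[of i]]
        by (simp add: h_def)
    qed
    also have "\<dots> = h s2 - h s1" using \<open>s1 \<le> s2\<close> by (simp add: sum_Suc_diff')
    finally show ?thesis using t1 t2 by (simp add: h_def g_def)
  qed
  moreover have "(\<Sum>i\<in>{..s1}. edge_weight (a i, b i)) + (\<Sum>i\<in>{s1<..s2}. edge_weight (a i, b i))
      + (\<Sum>i\<in>{s2<..n}. edge_weight (a i, b i)) = 0"
  proof -
    have "{..n} = {..s1} \<union> {s1<..s2} \<union> {s2<..n}" using \<open>s1 \<le> s2\<close> s_le by auto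
    moreover have "(\<Sum>i\<in>{..s1} \<union> {s1<..s2} \<union> {s2<..n}. edge_weight (a i, b i))
        = (\<Sum>i\<in>{..s1} \<union> {s1<..s2}. edge_weight (a i, b i))
          + (\<Sum>i\<in>{s2<..n}. edge_weight (a i, b i))"
      using \<open>s1 \<le> s2\<close> by (intro sum.union_disjoint) auto
    moreover have "(\<Sum>i\<in>{..s1} \<union> {s1<..s2}. edge_weight (a i, b i))
        = (\<Sum>i\<in>{..s1}. edge_weight (a i, b i)) + (\<Sum>i\<in>{s1<..s2}. edge_weight (a i, b i))"
      by (rule sum.union_disjoint) auto
    ultimately show ?thesis using wp by metis
  qed
  \<comment> \<open>The three parts of \<open>p\<close> weigh at most \<open>g t1 - 1\<close>,
    \<open>g t2 - g t1\<close> and \<open>- g t2\<close>, in total at most -1, whereas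
    \<open>p\<close> has weight 0.\<close>
  ultimately show False by linarith
qed

end

theorem mainTheorem10:
  fixes G :: "'v marriage_graph" and C :: "'v set" and M :: "('v \<times> 'v) set"
    and lev :: "'v \<Rightarrow> nat"
  assumes "marriage_instance G"
    and "C \<subseteq> men G"
    and "popular_feasible G C M"
    and "leveling G M lev"
  shows "\<not> (\<exists>v\<in>vertices G. (\<exists>p. SIAP G M p \<and> v \<in> set p) \<and> (\<exists>q. SRAP G C M lev q \<and> v \<in> set q))"
proof -
  interpret marriage_matching G M
    using assms by unfold_locales (auto simp: popular_feasible_def feasible_def)
  show ?thesis
    using SIAP_SRAP_disjoint[OF assms(3,2,4)] by blast
qed

end
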